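(* Let $m\ge 4$ be an integer and let $\mathcal A$ be an alphabet of $m$ letters. Let $p$ be a pattern that uses exactly $r\ge 1$ distinct variables, where the $j$th variable occurs $k_j\ge 1$ times in $p$, and where the variables are indexed so that $1=k_1=\cdots=k_s<k_{s+1}\le\cdots\le k_r$ (with $0\le s\le r$). Let $\widehat{\Omega}_n$ denote the mean number of occurrences of $p$ in the abelian sense in a word of length $n$ over $\mathcal A$. Then, as $n\to\infty$ with $p$ and $m$ fixed, $$\widehat{\Omega}_n\sim\frac{n^{s+1}}{(s+1)!}\prod_{j=s+1}^r\left[\sum_{\ell=1}^{\infty}\frac{1}{m^{k_j\ell}}\sum_{i_1+\cdots+i_m=\ell}\binom{\ell}{i_1,\ldots,i_m}^{k_j}\right].$$
   Context: A pattern is a nonempty word $p=p_1\cdots p_N$ over an alphabet of variables. The number of occurrences of $p$ in the abelian sense in a word $w$ over $\mathcal A$ is the sum, over all distinct sequences $(u_1,\ldots,u_N)$ of nonempty words over $\mathcal A$ such that $u_a$ can be obtained from $u_b$ by rearranging letters whenever $p_a=p_b$, of the number of positions at which $u_1\cdots u_N$ occurs as a factor (contiguous block) of $w$. The mean is taken over all $m^n$ words of length $n$ over $\mathcal A$, uniformly. The inner sums run over $m$-tuples $(i_1,\ldots,i_m)$ of nonnegative integers with sum $\ell$, and $\binom{\ell}{i_1,\ldots,i_m}$ is the multinomial coefficient. The notation $\sim$ means that the ratio of the two sides tends to $1$. Empty products equal $1$. *)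

theory Defs
  imports "HOL-Analysis.Analysis" "HOL-Library.Landau_Symbols" "HOL-Library.Multiset"
begin

definition abelian_instances :: "'a set \<Rightarrow> 'v list \<Rightarrow> 'a list list set" where
  "abelian_instances A p = {us. length us = length p \<and>
     (\<forall>a<length p. us ! a \<noteq> [] \<and> us ! a \<in> lists A) \<and>
     (\<forall>a<length p. \<forall>b<length p. p ! a = p ! b \<longrightarrow> mset (us ! a) = mset (us ! b))}"

definition factor_positions :: "'a list \<Rightarrow> 'a list \<Rightarrow> nat set" where
  "factor_positions v w = {i. i + length v \<le> length w \<and> take (length v) (drop i w) = v}"

text \<open>The set of instances is infinite, but only finitely many of them occur in a given word,
  so the following unordered sum is a finite one; see \<open>abelian_occurrences_finite_sum\<close>.\<close>

definition abelian_occurrences :: "'a set \<Rightarrow> 'v list \<Rightarrow> 'a list \<Rightarrow> nat" where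
  "abelian_occurrences A p w =
     (\<Sum>\<^sub>\<infinity>us\<in>abelian_instances A p. card (factor_positions (concat us) w))"

definition mean_abelian_occurrences :: "'a set \<Rightarrow> 'v list \<Rightarrow> nat \<Rightarrow> real" where
  "mean_abelian_occurrences A p n =
     (\<Sum>w | w \<in> lists A \<and> length w = n. real (abelian_occurrences A p w)) / real (card A) ^ n"

definition multinomial :: "nat list \<Rightarrow> real" where
  "multinomial is = fact (sum_list is) / (\<Prod>i\<leftarrow>is. fact i)"

definition multinomial_power_sum :: "nat \<Rightarrow> nat \<Rightarrow> nat \<Rightarrow> real" where
  "multinomial_power_sum m k l = (\<Sum>is | length is = m \<and> sum_list is = l. multinomial is ^ k)"

lemma finite_short_instances:
  assumes "finite A"
  shows "finite {us \<in> abelian_instances A p. length (concat us) \<le> L}"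
proof (rule finite_subset)
  show "{us \<in> abelian_instances A p. length (concat us) \<le> L}
    \<subseteq> {us. set us \<subseteq> {u. set u \<subseteq> A \<and> length u \<le> L} \<and> length us = length p}"
  proof -
    have "set u \<subseteq> A \<and> length u \<le> L"
      if us: "us \<in> abelian_instances A p" "length (concat us) \<le> L" and u: "u \<in> set us" for us u
    proof -
      obtain a where a: "a < length us" "u = us ! a"
        using u by (auto simp: in_set_conv_nth)
      have "length u \<le> length (concat us)"
        using u by (auto simp: length_concat intro!: member_le_sum_list)
      moreover have "u \<in> lists A"
        using us a by (auto simp: abelian_instances_def)
      ultimately show ?thesis
        using us by auto
    qed
    moreover have "length us = length p" if "us \<in> abelian_instances A p" for us
      using that by (simp add: abelian_instances_def)
    ultimately show ?thesis
      by blast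
  qed
  show "finite {us. set us \<subseteq> {u. set u \<subseteq> A \<and> length u \<le> L} \<and> length us = length p}"
    by (intro finite_lists_length_eq finite_lists_length_le assms)
qed

lemma abelian_occurrences_finite_sum:
  assumes "finite A"
  shows "abelian_occurrences A p w =
    (\<Sum>us | us \<in> abelian_instances A p \<and> length (concat us) \<le> length w.
       card (factor_positions (concat us) w))"
proof -
  have "abelian_occurrences A p w =
    infsum (\<lambda>us. card (factor_positions (concat us) w))
      {us \<in> abelian_instances A p. length (concat us) \<le> length w}"
    unfolding abelian_occurrences_def
    by (rule infsum_cong_neutral) (auto simp: factor_positions_def)
  then show ?thesis
    using finite_short_instances[OF assms, of p "length w"] by simp
qed

end

theory Submission
  imports Defs "HOL-Combinatorics.Multiset_Permutations" "HOL-Real_Asymp.Real_Asymp"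
begin

text \<open>
  By linearity of expectation the mean is the sum over all instances of \<open>(n + 1 - L) / m ^ L\<close>, where \<open>L \<le> n\<close>
  is the total length of the instance. Grouping instances by the multiset of letters chosen for each
  variable and then by its size \<open>l\<^sub>j\<close> gives
  \<open>\<Sum> (n + 1 - \<Sum>\<^sub>j k\<^sub>j l\<^sub>j) \<Prod>\<^sub>j c\<^sub>j(l\<^sub>j)\<close>, where \<open>c\<^sub>j(l)\<close> is the sum of the \<open>k\<^sub>j\<close>-th powers of the
  probabilities that a random word of length \<open>l\<close> has given letter counts. Variables with \<open>k\<^sub>j = 1\<close> have
  \<open>c\<^sub>j = 1\<close> and produce the binomial coefficient \<open>(n + 1) choose (s + 1)\<close>; each of the others is absorbed by
  dominated convergence (Tannery's theorem). The series \<open>\<Sum>\<^sub>l c\<^sub>j(l)\<close> converges because each of these probabilities is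
  \<open>O(l powr (-(m - 1) / 2))\<close>, hence \<open>O(l powr (-3 / 2))\<close> for \<open>m \<ge> 4\<close>.
\<close>

subsection \<open>Iterated weighted sums and their growth\<close>

text \<open>The truncated subtraction makes terms with \<open>k (Suc j) * l > N\<close> vanish, since the value at \<open>0\<close>
  is \<open>0\<close>; summing up to \<open>N\<close> therefore loses nothing as long as \<open>k \<ge> 1\<close>.\<close>

primrec conv_sum :: "(nat \<Rightarrow> nat \<Rightarrow> real) \<Rightarrow> (nat \<Rightarrow> nat) \<Rightarrow> nat \<Rightarrow> nat \<Rightarrow> real" where
  "conv_sum c k 0 N = real N"
| "conv_sum c k (Suc j) N = (\<Sum>l=1..N. c (Suc j) l * conv_sum c k j (N - k (Suc j) * l))"

lemma conv_sum_zero [simp]: "conv_sum c k j 0 = 0"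
  by (cases j) auto

text \<open>Hockey-stick identity: each summation with weight \<open>1\<close> raises the lower
  index by one, starting from \<open>N = N choose 1\<close>.\<close>

lemma conv_sum_eq_binomial:
  assumes "\<And>i l. i \<in> {1..j} \<Longrightarrow> k i = 1 \<and> c i l = 1"
  shows "conv_sum c k j N = real (N choose Suc j)"
  using assms
proof (induction j arbitrary: N)
  case (Suc j)
  have "conv_sum c k (Suc j) N = (\<Sum>l=1..N. real ((N - l) choose Suc j))"
    using Suc by simp
  also have "\<dots> = (\<Sum>i<N. real (i choose Suc j))"
    by (rule sum.reindex_bij_witness[of _ "\<lambda>i. N - i" "\<lambda>l. N - l"]) auto
  also have "\<dots> = real (N choose Suc (Suc j))"
    by (cases N) (auto simp: lessThan_Suc_atMost sum_choose_upper simp flip: of_nat_sum)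
  finally show ?case .
qed simp

lemma tendsto_shift_ratio: "(\<lambda>N. real N / real (N + a)) \<longlonglongrightarrow> 1"
  by (cases "a = 0") real_asymp+

lemma binomial_over_power_tendsto:
  "(\<lambda>N. real (N choose d) / real N ^ d) \<longlonglongrightarrow> 1 / fact d"
\<comment> \<open>Shifted by \<open>d\<close>, the binomial becomes \<open>(d + N) choose N\<close>,
  whose growth against \<open>N ^ d\<close> is known; the ratio \<open>N / (N + d)\<close> corrects
  the denominator.\<close>
proof (rule LIMSEQ_offset[where k = d])
  have "(\<lambda>N. real ((d + N) choose N) / real (N ^ d) * (real N / real (N + d)) ^ d) \<longlonglongrightarrow> 1 / fact d * 1 ^ d"
    by (intro tendsto_intros tendsto_shift_ratio fact_binomial_limit)
  moreover have "eventually (\<lambda>N. real ((d + N) choose N) / real (N ^ d) * (real N / real (N + d)) ^ d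
      = real ((N + d) choose d) / real (N + d) ^ d) at_top"
    using eventually_gt_at_top[of 0]
  proof eventually_elim
    case (elim N)
    have "(d + N) choose N = (N + d) choose d"
      using binomial_symmetric[of N "d + N"] by (simp add: add.commute)
    then show ?case
      using elim by (simp add: field_simps power_divide)
  qed
  ultimately show "(\<lambda>N. real ((N + d) choose d) / real (N + d) ^ d) \<longlonglongrightarrow> 1 / fact d"
    by (auto elim: Lim_transform_eventually)
qed

text \<open>A fixed shift \<open>k * l\<close> does not change the leading growth of
  \<open>f\<close>, so each term tends to \<open>c l * C\<close>. Boundedness of
  \<open>f N / N ^ d\<close> supplies the summable majorant for Tannery's theorem.\<close>

lemma convolution_tendsto:
  fixes f c :: "nat \<Rightarrow> real"
  assumes lim: "(\<lambda>N. f N / real N ^ d) \<longlonglongrightarrow> C" and "f 0 = 0" and "k \<ge> 1"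
    and c: "\<And>l. c l \<ge> 0" "summable (\<lambda>l. c (Suc l))"
  shows "(\<lambda>N. (\<Sum>l=1..N. c l * f (N - k * l)) / real N ^ d) \<longlonglongrightarrow> C * (\<Sum>l. c (Suc l))"
proof -
  define a where "a = (\<lambda>l N. c (Suc l) * (f (N - k * Suc l) / real N ^ d))"
  obtain K where K: "\<And>N. \<bar>f N / real N ^ d\<bar> \<le> K"
    using lim[THEN convergentI, THEN convergent_imp_Bseq] by (auto simp: Bseq_def)
  have "K \<ge> 0"
    using K[of 0] by linarith
  have bound: "norm (a l N) \<le> c (Suc l) * K" for l N
  proof -
    have "\<bar>f (N - b) / real N ^ d\<bar> \<le> K" for b
    proof (cases "N - b = 0")
      case False
      \<comment> \<open>Shrinking the denominator reduces the claim to the bound \<open>K\<close> at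
        the argument \<open>N - b\<close>.\<close>
      have "\<bar>f (N - b) / real N ^ d\<bar> \<le> \<bar>f (N - b) / real (N - b) ^ d\<bar>"
        using False by (auto simp: abs_divide intro!: divide_left_mono power_mono)
      then show ?thesis using K[of "N - b"] by linarith
    qed (use \<open>K \<ge> 0\<close> assms in auto)
    then have "c (Suc l) * \<bar>f (N - k * Suc l) / real N ^ d\<bar> \<le> c (Suc l) * K"
      using c(1) by (intro mult_left_mono)
    then show ?thesis
      using c(1) by (simp only: a_def real_norm_def abs_mult abs_of_nonneg)
  qed
  have limit: "(\<lambda>N. a l N) \<longlonglongrightarrow> c (Suc l) * C" for l
    unfolding a_def
  proof (intro tendsto_mult_left, rule LIMSEQ_offset[where k = "k * Suc l"])
    let ?b = "k * Suc l"
    have "(\<lambda>N. f N / real N ^ d * (real N / real (N + ?b)) ^ d) \<longlonglongrightarrow> C * 1 ^ d"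
      by (intro tendsto_intros tendsto_shift_ratio lim)
    moreover have "eventually (\<lambda>N. f N / real N ^ d * (real N / real (N + ?b)) ^ d
        = f (N + ?b - ?b) / real (N + ?b) ^ d) at_top"
      using eventually_gt_at_top[of 0] by eventually_elim (simp add: field_simps power_divide)
    ultimately show "(\<lambda>N. f (N + ?b - ?b) / real (N + ?b) ^ d) \<longlonglongrightarrow> C"
      by (auto elim: Lim_transform_eventually)
  qed
  have "eventually (\<lambda>(l, N). norm (a l N) \<le> c (Suc l) * K) (at_top \<times>\<^sub>F sequentially)"
    using bound by (auto intro: always_eventually)
  then have "(\<lambda>N. \<Sum>l. a l N) \<longlonglongrightarrow> (\<Sum>l. c (Suc l) * C)"
    using tannerys_theorem[of a _ sequentially, OF limit _ summable_mult2[OF c(2)]] by simp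
  moreover have "(\<Sum>l. a l N) = (\<Sum>l=1..N. c l * f (N - k * l)) / real N ^ d" for N
  proof -
    \<comment> \<open>The series is a finite sum in disguise: from \<open>l = N\<close> on,
      \<open>f\<close> is evaluated at \<open>0\<close>.\<close>
    have "N - k * Suc l = 0" if "l \<ge> N" for l
    proof -
      have "N \<le> 1 * Suc l" using that by simp
      also have "\<dots> \<le> k * Suc l" using \<open>k \<ge> 1\<close> by (intro mult_le_mono1)
      finally show ?thesis by simp
    qed
    then have "(\<Sum>l. a l N) = (\<Sum>l<N. a l N)"
      using \<open>f 0 = 0\<close> by (intro suminf_finite) (auto simp: a_def simp del: mult_Suc_right)
    also have "\<dots> = (\<Sum>l=1..N. c l * (f (N - k * l) / real N ^ d))"
      unfolding a_def by (rule sum.reindex_bij_witness[of _ "\<lambda>l. l - 1" Suc]) auto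
    finally show ?thesis by (simp add: sum_divide_distrib)
  qed
  ultimately show ?thesis
    using suminf_mult2[OF c(2), of C] by (simp add: mult.commute)
qed

text \<open>The weight-one variables come first and fix the order \<open>s + 1\<close> of growth;
  every further variable only multiplies the limit by a convergent series.\<close>

lemma conv_sum_tendsto:
  assumes "s \<le> r"
    and "\<And>i l. i \<in> {1..s} \<Longrightarrow> k i = 1 \<and> c i l = 1"
    and "\<And>i. i \<in> {s+1..r} \<Longrightarrow> k i \<ge> 1 \<and> (\<forall>l. c i l \<ge> 0) \<and> summable (\<lambda>l. c i (Suc l))"
  shows "(\<lambda>N. conv_sum c k r N / real N ^ (s + 1))
    \<longlonglongrightarrow> 1 / fact (s + 1) * (\<Prod>i\<in>{s+1..r}. \<Sum>l. c i (Suc l))"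
  using assms(1,3)
proof (induction r rule: dec_induct)
  case base
  show ?case
    using binomial_over_power_tendsto[of "Suc s"] conv_sum_eq_binomial[of s k c] assms(2) by simp
next
  case (step j)
  have "(\<lambda>N. (\<Sum>l=1..N. c (Suc j) l * conv_sum c k j (N - k (Suc j) * l)) / real N ^ (s + 1))
    \<longlonglongrightarrow> (1 / fact (s + 1) * (\<Prod>i\<in>{s+1..j}. \<Sum>l. c i (Suc l))) * (\<Sum>l. c (Suc j) (Suc l))"
    using step by (intro convolution_tendsto) auto
  then show ?case
    using step(1) by (simp add: prod.nat_ivl_Suc' mult_ac)
qed

subsection \<open>Decay of multinomial probabilities\<close>

text \<open>The quotient of consecutive values of \<open>(q + 1) ^ i / fact i\<close> is
  \<open>(q + 1) / (i + 1)\<close>, which is at least \<open>1\<close> for \<open>i \<le> q\<close>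
  and at most \<open>1\<close> for \<open>i \<ge> q\<close>; so the maximum is attained at
  \<open>i = q\<close>.\<close>

lemma fact_mult_power_le:
  fixes q i :: nat
  shows "fact q * (q + 1) ^ i \<le> (fact i * (q + 1) ^ q :: nat)"
proof (cases "q \<le> i")
  case True
  then show ?thesis
  proof (induction i rule: dec_induct)
    case (step i)
    have "(q + 1) * (fact q * (q + 1) ^ i) \<le> Suc i * (fact i * (q + 1) ^ q :: nat)"
      using step by (intro mult_le_mono[OF _ step.IH]) auto
    then show ?case by (simp add: algebra_simps)
  qed simp
next
  case False
  then have "i \<le> q" by simp
  then show ?thesis
  proof (induction i rule: inc_induct)
    case (step i)
    have "(q + 1) * (fact q * (q + 1) ^ i) \<le> Suc i * (fact i * (q + 1) ^ q :: nat)"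
      using step.IH by (simp add: algebra_simps)
    also have "\<dots> \<le> (q + 1) * (fact i * (q + 1) ^ q)"
      using step by (intro mult_right_mono) auto
    finally show ?case by (subst (asm) mult_le_cancel1) simp
  qed simp
qed

text \<open>Multiplied over all entries, the previous bound sees only the length and the sum of the
  list, and so bounds the denominator of every multinomial coefficient from below.\<close>

lemma fact_power_mult_le_prod_list:
  "fact q ^ length is * (q + 1) ^ sum_list is
    \<le> ((\<Prod>i\<leftarrow>is. fact i) * (q + 1) ^ (q * length is) :: nat)"
proof (induction "is")
  case (Cons i "is")
  have "(fact q * (q + 1) ^ i) * (fact q ^ length is * (q + 1) ^ sum_list is)
      \<le> (fact i * (q + 1) ^ q) * ((\<Prod>i\<leftarrow>is. fact i) * (q + 1) ^ (q * length is) :: nat)"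
    by (intro mult_mono Cons fact_mult_power_le) auto
  then show ?case by (simp add: mult_ac power_add)
qed simp

lemma fact_add_le: "fact (a + t) \<le> (fact a * (a + t) ^ t :: nat)"
proof -
  \<comment> \<open>The base is decoupled from \<open>t\<close> so that it stays fixed during the
    induction.\<close>
  have "fact (a + t) \<le> fact a * b ^ t" if "a + t \<le> b" for b :: nat
    using that
  proof (induction t)
    case (Suc t)
    have "(a + Suc t) * fact (a + t) \<le> b * (fact a * b ^ t)"
      using Suc by (intro mult_mono) auto
    then show ?case by (simp add: mult_ac)
  qed simp
  then show ?thesis by simp
qed

text \<open>The probability that a uniformly random word of length \<open>m * q\<close> over \<open>m\<close> letters contains
  each letter \<open>q\<close> times.\<close>

definition balanced_prob :: "nat \<Rightarrow> nat \<Rightarrow> real" where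
  "balanced_prob m q = fact (m * q) / (fact q ^ m * real m ^ (m * q))"

lemma balanced_prob_nonneg: "balanced_prob m q \<ge> 0"
  by (simp add: balanced_prob_def)

text \<open>The quotient of the two values is \<open>\<Prod>j=1..m. (1 - (m - j) / (m * Suc q))\<close>, which is bounded
  through \<open>1 - x \<le> exp (- x)\<close>.\<close>

lemma balanced_prob_Suc_le:
  assumes "m \<ge> 4"
  shows "balanced_prob m (Suc q) \<le> balanced_prob m q * exp (- (3 / 2) / real (Suc q))"
proof -
  let ?b = "real m * real (Suc q)"
  have fact_split: "fact (a + t) = fact a * (\<Prod>j=1..t. real (a + j))" for a t :: nat
    by (induction t) (auto simp: algebra_simps)
  have pos: "?b > 0" using assms by simp
  have "balanced_prob m (Suc q) = balanced_prob m q * ((\<Prod>j=1..m. real (m * q + j)) / ?b ^ m)"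
  proof -
    have "fact (Suc q) ^ m = (fact q ^ m * real (Suc q) ^ m :: real)"
      by (simp add: power_mult_distrib mult.commute)
    moreover have "m * Suc q = m * q + m" by simp
    ultimately show ?thesis
      unfolding balanced_prob_def using fact_split[of "m * q" m]
      by (simp only: power_mult_distrib power_add times_divide_times_eq mult_ac)
  qed
  also have "(\<Prod>j=1..m. real (m * q + j)) / ?b ^ m = (\<Prod>j=1..m. real (m * q + j) / ?b)"
    by (simp add: prod_dividef)
  also have "\<dots> \<le> (\<Prod>j=1..m. exp (- (real (m - j) / ?b)))"
  proof (intro prod_mono conjI)
    fix j assume "j \<in> {1..m}"
    then have "real (m * q + j) / ?b = 1 + - (real (m - j) / ?b)"
      using pos by (simp add: of_nat_diff field_simps)
    also have "\<dots> \<le> exp (- (real (m - j) / ?b))"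
      by (rule exp_ge_add_one_self)
    finally show "real (m * q + j) / ?b \<le> exp (- (real (m - j) / ?b))" .
  qed (use pos in simp)
  also have "\<dots> = exp (- ((\<Sum>j=1..m. real (m - j)) / ?b))"
    by (simp add: exp_sum[symmetric] sum_negf sum_divide_distrib)
  also have "(\<Sum>j=1..m. real (m - j)) = (\<Sum>j<m. real j)"
    by (rule sum.reindex_bij_witness[of _ "\<lambda>j. m - j" "\<lambda>j. m - j"]) auto
  also have "(\<Sum>j<m. real j) = real m * (real m - 1) / 2"
    by (induction m) (auto simp: field_simps)
  \<comment> \<open>Here \<open>m \<ge> 4\<close> enters: \<open>(m - 1) / 2 \<ge> 3 / 2\<close>, an
    exponent above \<open>1\<close>, as summability later demands.\<close>
  also have "exp (- (real m * (real m - 1) / 2 / ?b)) \<le> exp (- (3 / 2) / real (Suc q))"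
  proof -
    have "real m * (real m - 1) / 2 / ?b = (real m - 1) / 2 / real (Suc q)"
      using assms by simp
    moreover have "(3 / 2) / real (Suc q) \<le> (real m - 1) / 2 / real (Suc q)"
      using assms by (intro divide_right_mono) auto
    ultimately show ?thesis by simp
  qed
  finally show ?thesis
    by (simp only: mult_left_mono balanced_prob_nonneg)
qed

text \<open>By \<open>1 + x \<le> exp x\<close>, each decay factor is at most
  \<open>((q + 2) / (q + 1)) powr (- 3 / 2)\<close>, and these factors telescope.\<close>

lemma balanced_prob_le:
  assumes "m \<ge> 4"
  shows "balanced_prob m q \<le> real (q + 1) powr (- 3 / 2)"
proof (induction q)
  case (Suc q)
  have "exp (- (3 / 2) / real (Suc q)) = exp (1 / real (Suc q)) powr (- 3 / 2)"
    by (simp only: exp_powr_real) simp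
  also have "\<dots> \<le> (1 + 1 / real (Suc q)) powr (- 3 / 2)"
    by (intro powr_mono2' exp_ge_add_one_self) (auto intro: add_pos_nonneg)
  finally have "balanced_prob m (Suc q)
      \<le> real (q + 1) powr (- 3 / 2) * (1 + 1 / real (Suc q)) powr (- 3 / 2)"
    using balanced_prob_Suc_le[OF assms, of q] Suc
    by (smt (verit) mult_mono exp_ge_zero powr_ge_zero)
  also have "\<dots> = (real (q + 1) * (1 + 1 / real (Suc q))) powr (- 3 / 2)"
    by (rule powr_mult[symmetric])
  also have "real (q + 1) * (1 + 1 / real (Suc q)) = real (Suc q + 1)"
    by (simp add: field_simps)
  finally show ?case .
qed (simp add: balanced_prob_def)

text \<open>Write the sum as \<open>m * q + t\<close>. Its factorial is at most
  \<open>fact (m * q) * (m * (q + 1)) ^ t\<close>, while the product of factorials is at least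
  \<open>fact q ^ m * (q + 1) ^ t\<close>; the contributions of the remainder \<open>t\<close>
  cancel.\<close>

lemma multinomial_over_power_le:
  assumes "length is = m" "m \<ge> 1"
  shows "multinomial is / real m ^ sum_list is \<le> balanced_prob m (sum_list is div m)"
proof -
  define l q t where "l = sum_list is" and "q = l div m" and "t = l mod m"
  have l: "l = m * q + t" and "t \<le> m"
    using \<open>m \<ge> 1\<close> by (auto simp: q_def t_def intro: less_imp_le)
  define P where "P = (\<Prod>i\<leftarrow>is. fact i :: real)"
  have P_nat: "P = real (\<Prod>i\<leftarrow>is. fact i)"
    unfolding P_def by (induction "is") auto
  have P: "P > 0"
    unfolding P_def by (induction "is") auto
  have 1: "fact q ^ m * real (q + 1) ^ l \<le> P * real (q + 1) ^ (q * m)"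
    using of_nat_mono[where 'a = real, OF fact_power_mult_le_prod_list[of q "is"]] assms(1)
    by (simp only: P_nat l_def of_nat_mult of_nat_power of_nat_fact)
  have "fact q ^ m * real (q + 1) ^ t * real (q + 1) ^ (q * m) \<le> P * real (q + 1) ^ (q * m)"
    using 1 unfolding l power_add by (simp only: mult_ac)
  then have 2: "fact q ^ m * real (q + 1) ^ t \<le> P"
    by (rule mult_right_le_imp_le) simp
  have "fact l \<le> fact (m * q) * (real (m * q + t)) ^ t"
    using of_nat_mono[where 'a = real, OF fact_add_le[of "m * q" t]]
    by (simp only: l of_nat_mult of_nat_power of_nat_fact)
  also have "\<dots> \<le> fact (m * q) * (real m * real (q + 1)) ^ t"
    using \<open>t \<le> m\<close> by (intro mult_left_mono power_mono) (auto simp: algebra_simps)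
  finally have 3: "fact l \<le> fact (m * q) * (real m * real (q + 1)) ^ t" .
  have "multinomial is / real m ^ l = fact l / (P * real m ^ l)"
    by (simp add: multinomial_def P_def l_def)
  also have "\<dots> \<le> (fact (m * q) * (real m * real (q + 1)) ^ t)
      / (fact q ^ m * real (q + 1) ^ t * real m ^ l)"
    using 2 3 assms(2) P by (intro frac_le mult_right_mono) auto
  also have "\<dots> = balanced_prob m q"
  proof -
    have "F * (x * y) ^ t / (Q * y ^ t * x ^ (n + t)) = F / (Q * x ^ n)"
      if "x \<noteq> 0" "y \<noteq> 0" for F Q x y :: real and n
      using that by (simp add: power_mult_distrib power_add)
    then show ?thesis
      using assms(2) by (simp add: balanced_prob_def l)
  qed
  finally show ?thesis by (simp add: l_def q_def)
qed

lemma balanced_prob_div_le: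
  assumes "m \<ge> 4" and "l > 0"
  shows "balanced_prob m (l div m) \<le> real m powr (3 / 2) * real l powr (- 3 / 2)"
proof -
  have "l < m * (l div m + 1)"
    using assms dividend_less_times_div[of m l] by simp
  then have "real l \<le> real m * real (l div m + 1)"
    by (metis less_imp_le of_nat_le_iff of_nat_mult)
  then have "real l / real m \<le> real (l div m + 1)"
    using assms by (simp add: field_simps)
  then have "real (l div m + 1) powr (- 3 / 2) \<le> (real l / real m) powr (- 3 / 2)"
    using assms by (intro powr_mono2') auto
  also have "\<dots> = real m powr (3 / 2) * real l powr (- 3 / 2)"
    using assms by (simp add: powr_divide powr_minus field_simps)
  finally show ?thesis
    using balanced_prob_le[OF assms(1), of "l div m"] by linarith
qed

subsection \<open>Instances grouped by letter counts\<close>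

text \<open>Double counting: at each admissible position the word \<open>v\<close> fixes
  \<open>length v\<close> letters, and the prefix and suffix around it are free.\<close>

lemma sum_factor_positions:
  assumes "finite A" and v: "v \<in> lists A" and "length v \<le> n"
  shows "(\<Sum>w | w \<in> lists A \<and> length w = n. card (factor_positions v w))
    = (n + 1 - length v) * card A ^ (n - length v)"
proof -
  define L where "L = length v"
  define W where "W = {w. w \<in> lists A \<and> length w = n}"
  have words: "finite {w. w \<in> lists A \<and> length w = j}"
    "card {w. w \<in> lists A \<and> length w = j} = card A ^ j" for j
    using finite_lists_length_eq[OF assms(1), of j] card_lists_length_eq[OF assms(1), of j]
    by (simp_all add: lists_eq_set)
  have fixed: "card {w \<in> W. take L (drop i w) = v} = card A ^ (n - L)" if "i \<le> n - L" for i
  proof -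
    let ?X = "{x. x \<in> lists A \<and> length x = i}"
    let ?Y = "{y. y \<in> lists A \<and> length y = n - L - i}"
    have "{w \<in> W. take L (drop i w) = v} = (\<lambda>(x, y). x @ v @ y) ` (?X \<times> ?Y)"
    proof (intro equalityI subsetI)
      fix w assume w: "w \<in> {w \<in> W. take L (drop i w) = v}"
      then have "v = take L (drop i w)" by simp
      then have "w = take i w @ v @ drop (i + L) w"
        by (metis append_take_drop_id drop_drop add.commute)
      moreover have "take i w \<in> ?X" "drop (i + L) w \<in> ?Y"
        using w that assms(3) unfolding W_def L_def by (auto dest: in_set_takeD in_set_dropD)
      ultimately show "w \<in> (\<lambda>(x, y). x @ v @ y) ` (?X \<times> ?Y)"
        by (intro image_eqI[of _ _ "(take i w, drop (i + L) w)"]) auto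
    qed (use that v assms(3) in \<open>auto simp: W_def L_def\<close>)
    moreover have "inj_on (\<lambda>(x, y). x @ v @ y) (?X \<times> ?Y)"
      by (auto simp: inj_on_def)
    moreover have "card A ^ i * card A ^ (n - L - i) = card A ^ (n - L)"
      using that by (metis le_add_diff_inverse power_add)
    ultimately show ?thesis
      by (simp add: card_image card_cartesian_product words)
  qed
  have "card (factor_positions v w) = (\<Sum>i\<le>n - L. of_bool (take L (drop i w) = v))" if "w \<in> W" for w
  proof -
    have "factor_positions v w = {i \<in> {..n - L}. take L (drop i w) = v}"
      using that assms(3) by (auto simp: factor_positions_def W_def L_def)
    then show ?thesis
      by (simp add: of_bool_def sum.If_cases Int_def)
  qed
  then have "(\<Sum>w\<in>W. card (factor_positions v w))
      = (\<Sum>w\<in>W. \<Sum>i\<le>n - L. of_bool (take L (drop i w) = v))"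
    by simp
  also have "\<dots> = (\<Sum>i\<le>n - L. card {w \<in> W. take L (drop i w) = v})"
    using words(1)[of n] by (subst sum.swap) (simp add: of_bool_def sum.If_cases Int_def W_def)
  also have "\<dots> = (n + 1 - L) * card A ^ (n - L)"
    using fixed assms(3) by (simp add: L_def Suc_diff_le)
  finally show ?thesis by (simp add: W_def L_def)
qed

lemma concat_instance_in_lists:
  assumes "us \<in> abelian_instances A p"
  shows "concat us \<in> lists A"
  using assms unfolding abelian_instances_def in_lists_conv_set
  by (auto simp: set_conv_nth[of us])

lemma mean_abelian_occurrences_eq:
  assumes "finite A" and "card A > 0"
  shows "mean_abelian_occurrences A p n =
    (\<Sum>us | us \<in> abelian_instances A p \<and> length (concat us) \<le> n.
       real (n + 1 - length (concat us)) / real (card A) ^ length (concat us))"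
proof -
  let ?I = "{us. us \<in> abelian_instances A p \<and> length (concat us) \<le> n}"
  let ?W = "{w. w \<in> lists A \<and> length w = n}"
  have "(\<Sum>w\<in>?W. real (abelian_occurrences A p w))
      = (\<Sum>w\<in>?W. \<Sum>us\<in>?I. real (card (factor_positions (concat us) w)))"
    by (intro sum.cong) (auto simp: abelian_occurrences_finite_sum[OF assms(1)])
  also have "\<dots> = (\<Sum>us\<in>?I. real (\<Sum>w\<in>?W. card (factor_positions (concat us) w)))"
    by (subst sum.swap) simp
  also have "\<dots> = (\<Sum>us\<in>?I. real (n + 1 - length (concat us)) * real (card A) ^ (n - length (concat us)))"
    using concat_instance_in_lists[of _ A p]
    by (intro sum.cong) (simp_all add: sum_factor_positions[OF assms(1)])
  finally have "mean_abelian_occurrences A p n =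
      (\<Sum>us\<in>?I. real (n + 1 - length (concat us)) * real (card A) ^ (n - length (concat us)) / real (card A) ^ n)"
    by (simp add: mean_abelian_occurrences_def sum_divide_distrib)
  also have "\<dots> = (\<Sum>us\<in>?I. real (n + 1 - length (concat us)) / real (card A) ^ length (concat us))"
    using assms(2) by (intro sum.cong) (auto simp: power_diff)
  finally show ?thesis .
qed

section \<open>Partition of the instances by the letter multisets of the variables\<close>

text \<open>One group of instances: once \<open>M\<close> is fixed, the positions of
  \<open>p\<close> are filled independently, and \<open>list_all2\<close> makes them countable by
  recursion on \<open>p\<close>.\<close>

abbreviation word_class_profile :: "'v list \<Rightarrow> ('v \<Rightarrow> 'a multiset) \<Rightarrow> 'a list list set" where
  "word_class_profile p M \<equiv> {us. list_all2 (\<lambda>u v. u \<in> permutations_of_multiset (M v)) us p}"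

text \<open>Independent positions give one factor each; collecting the equal factors of a variable
  produces the exponent \<open>count_list p v\<close>.\<close>

lemma card_word_class_profile:
  "finite (word_class_profile p M)"
  "card (word_class_profile p M) = (\<Prod>v\<in>set p. card (permutations_of_multiset (M v)) ^ count_list p v)"
proof -
  have "finite (word_class_profile p M) \<and>
    card (word_class_profile p M) = prod_mset (image_mset (\<lambda>v. card (permutations_of_multiset (M v))) (mset p))"
  proof (induction p)
    case (Cons v p)
    have "word_class_profile (v # p) M
        = (\<lambda>(u, us). u # us) ` (permutations_of_multiset (M v) \<times> word_class_profile p M)"
      by (auto simp: list_all2_Cons2)
    moreover have "inj_on (\<lambda>(u, us). u # us) (permutations_of_multiset (M v) \<times> word_class_profile p M)"
      by (auto simp: inj_on_def)
    ultimately show ?case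
      using Cons by (simp add: card_image card_cartesian_product)
  qed simp
  then show "finite (word_class_profile p M)"
    "card (word_class_profile p M) = (\<Prod>v\<in>set p. card (permutations_of_multiset (M v)) ^ count_list p v)"
    by (simp_all add: image_prod_mset_multiplicity count_mset)
qed

lemma length_concat_word_class_profile:
  assumes "us \<in> word_class_profile p M"
  shows "length (concat us) = (\<Sum>v\<in>set p. count_list p v * size (M v))"
proof -
  have "length (concat us) = sum_list (map (\<lambda>v. size (M v)) p)"
    using assms unfolding mem_Collect_eq
    by (induction us p rule: list_all2_induct) (auto simp: length_finite_permutations_of_multiset)
  then show ?thesis by (simp add: sum_list_map_eq_sum_count)
qed

text \<open>Sizes start at \<open>1\<close> because instances consist of nonempty words; the upper
  bound keeps the index set finite over a finite alphabet.\<close>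

abbreviation short_multisets :: "'a set \<Rightarrow> nat \<Rightarrow> 'a multiset set" where
  "short_multisets A n \<equiv> (\<Union>l\<in>{1..n}. multisets_of_size A l)"

text \<open>The words at all positions of one variable share a multiset, so every instance
  determines an assignment \<open>M\<close>. Together with disjointness this yields the
  partition.\<close>

lemma Union_word_class_profile:
  "(\<Union>M\<in>set p \<rightarrow>\<^sub>E short_multisets A n. word_class_profile p M)
    = {us \<in> abelian_instances A p. \<forall>u\<in>set us. length u \<le> n}"
proof (intro equalityI subsetI)
  fix us assume "us \<in> (\<Union>M\<in>set p \<rightarrow>\<^sub>E short_multisets A n. word_class_profile p M)"
  then obtain M where M: "M \<in> set p \<rightarrow>\<^sub>E short_multisets A n" and us: "us \<in> word_class_profile p M"
    by blast
  have len: "length us = length p"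
    using us by (auto dest: list_all2_lengthD)
  have nth: "mset (us ! a) = M (p ! a)" if "a < length p" for a
    using us that len by (auto simp: list_all2_conv_all_nth permutations_of_multiset_def)
  have "set_mset (M v) \<subseteq> A \<and> size (M v) \<in> {1..n}" if "v \<in> set p" for v
    using PiE_mem[OF M that] by (auto simp: multisets_of_size_def)
  then have "set_mset (mset (us ! a)) \<subseteq> A \<and> size (mset (us ! a)) \<in> {1..n}" if "a < length p" for a
    using that nth[OF that] by simp
  then have elem: "us ! a \<noteq> [] \<and> us ! a \<in> lists A" and short: "length (us ! a) \<le> n"
    if "a < length p" for a
    using that by (auto simp: lists_eq_set Suc_le_eq)
  have "us \<in> abelian_instances A p"
    unfolding abelian_instances_def mem_Collect_eq
  proof (intro conjI allI impI)
    fix a b assume "a < length p" "b < length p" "p ! a = p ! b"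
    then show "mset (us ! a) = mset (us ! b)"
      by (simp only: nth)
  qed (use len elem in blast)+
  moreover have "\<forall>u\<in>set us. length u \<le> n"
    using short len by (metis in_set_conv_nth)
  ultimately show "us \<in> {us \<in> abelian_instances A p. \<forall>u\<in>set us. length u \<le> n}"
    by blast
next
  fix us assume "us \<in> {us \<in> abelian_instances A p. \<forall>u\<in>set us. length u \<le> n}"
  then have inst: "us \<in> abelian_instances A p" and "\<forall>u\<in>set us. length u \<le> n"
    by blast+
  note inst_iff = inst[unfolded abelian_instances_def mem_Collect_eq]
  have len: "length us = length p"
    by (rule inst_iff[THEN conjunct1])
  have elem: "us ! a \<noteq> [] \<and> us ! a \<in> lists A" if "a < length p" for a
    by (rule inst_iff[THEN conjunct2, THEN conjunct1, rule_format, OF that])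
  have eq: "mset (us ! a) = mset (us ! b)" if "a < length p" "b < length p" "p ! a = p ! b" for a b
    by (rule inst_iff[THEN conjunct2, THEN conjunct2, rule_format, OF that])
  have short: "length (us ! a) \<le> n" if "a < length p" for a
    using \<open>\<forall>u\<in>set us. length u \<le> n\<close> that len by simp
  \<comment> \<open>Any position of \<open>v\<close> may represent it; \<open>restrict\<close> puts
    \<open>M\<close> into the extensional function space.\<close>
  define M where "M = restrict (\<lambda>v. mset (us ! (SOME a. a < length p \<and> p ! a = v))) (set p)"
  have M: "mset (us ! a) = M (p ! a)" if "a < length p" for a
  proof -
    let ?b = "SOME b. b < length p \<and> p ! b = p ! a"
    have "?b < length p \<and> p ! ?b = p ! a"
      by (rule someI[of _ a]) (use that in simp)
    then have "mset (us ! a) = mset (us ! ?b)"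
      by (intro eq that) simp_all
    also have "\<dots> = M (p ! a)"
      using nth_mem[OF that] by (simp only: M_def restrict_apply if_True)
    finally show ?thesis .
  qed
  have "M v \<in> short_multisets A n" if v: "v \<in> set p" for v
  proof -
    obtain a where a: "a < length p" "v = p ! a"
      using v by (metis in_set_conv_nth)
    then show ?thesis
      using M[OF a(1), symmetric] elem[OF a(1)] short[OF a(1)]
      by (auto simp: multisets_of_size_def Suc_le_eq)
  qed
  then have "M \<in> set p \<rightarrow>\<^sub>E short_multisets A n"
    by (auto simp: M_def)
  moreover have "us \<in> word_class_profile p M"
    using M len by (auto simp: list_all2_conv_all_nth permutations_of_multiset_def)
  ultimately show "us \<in> (\<Union>M\<in>set p \<rightarrow>\<^sub>E short_multisets A n. word_class_profile p M)"
    by blast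
qed

text \<open>A word placed at a position of \<open>v\<close> determines \<open>M v\<close>, and
  extensionality fixes \<open>M\<close> outside \<open>set p\<close>.\<close>

lemma word_class_profile_disjoint:
  assumes "M \<in> set p \<rightarrow>\<^sub>E X" "M' \<in> set p \<rightarrow>\<^sub>E X" "M \<noteq> M'"
  shows "word_class_profile p M \<inter> word_class_profile p M' = {}"
proof (rule ccontr)
  assume "word_class_profile p M \<inter> word_class_profile p M' \<noteq> {}"
  then obtain us where "us \<in> word_class_profile p M" "us \<in> word_class_profile p M'"
    by blast
  then have "M (p ! a) = M' (p ! a)" if "a < length p" for a
    using that by (auto simp: list_all2_conv_all_nth permutations_of_multiset_def)
  then have "M = M'"
    using assms(1,2) by (intro PiE_ext[of M _ "\<lambda>_. X"]) (auto simp: in_set_conv_nth)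
  then show False using assms(3) by simp
qed

lemma finite_multisets_of_size:
  assumes "finite A"
  shows "finite (multisets_of_size A l)"
proof (rule finite_subset)
  show "multisets_of_size A l \<subseteq> mset ` {xs. set xs \<subseteq> A \<and> length xs = l}"
  proof
    fix M assume "M \<in> multisets_of_size A l"
    moreover obtain xs where "mset xs = M"
      using ex_mset by blast
    ultimately show "M \<in> mset ` {xs. set xs \<subseteq> A \<and> length xs = l}"
      by (auto simp: multisets_of_size_def)
  qed
qed (intro finite_imageI finite_lists_length_eq assms)

text \<open>The probability that a uniformly random word over \<open>m\<close> letters of length \<open>size M\<close> is an
  arrangement of \<open>M\<close>.\<close>

definition class_prob :: "nat \<Rightarrow> 'a multiset \<Rightarrow> real" where
  "class_prob m M = real (card (permutations_of_multiset M)) / real m ^ size M"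

text \<open>Overlong instances enter with the truncated coefficient \<open>n + 1 - L = 0\<close>, so
  the constraint on the total length leaves the index set and each variable ranges
  independently.\<close>

lemma mean_abelian_occurrences_eq_sum_profiles:
  fixes A :: "'a set" and p :: "'v list"
  assumes "finite A" and "card A > 0"
  shows "mean_abelian_occurrences A p n =
    (\<Sum>M\<in>set p \<rightarrow>\<^sub>E short_multisets A (n + 1).
       real (n + 1 - (\<Sum>v\<in>set p. count_list p v * size (M v))) *
       (\<Prod>v\<in>set p. class_prob (card A) (M v) ^ count_list p v))"
proof -
  define F where "F = (\<lambda>L. real (n + 1 - L) / real (card A) ^ L)"
  let ?S = "set p \<rightarrow>\<^sub>E short_multisets A (n + 1)"
  have fin: "finite ?S"
    by (intro finite_PiE finite_UN_I finite_multisets_of_size assms) auto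
  have "mean_abelian_occurrences A p n
      = (\<Sum>us | us \<in> abelian_instances A p \<and> length (concat us) \<le> n. F (length (concat us)))"
    unfolding mean_abelian_occurrences_eq[OF assms] F_def ..
  also have "\<dots> = (\<Sum>us\<in>(\<Union>M\<in>?S. word_class_profile p M). F (length (concat us)))"
  proof (rule sum.mono_neutral_left)
    show "finite (\<Union>M\<in>?S. word_class_profile p M)"
      by (intro finite_UN_I fin card_word_class_profile)
    have "length u \<le> length (concat us)" if "u \<in> set us" for us :: "'a list list" and u
      using that by (auto simp: length_concat intro!: member_le_sum_list)
    then show "{us. us \<in> abelian_instances A p \<and> length (concat us) \<le> n} \<subseteq> (\<Union>M\<in>?S. word_class_profile p M)"
      unfolding Union_word_class_profile by (fastforce intro: order_trans)
    show "\<forall>us\<in>(\<Union>M\<in>?S. word_class_profile p M) - {us. us \<in> abelian_instances A p \<and> length (concat us) \<le> n}.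
        F (length (concat us)) = 0"
      unfolding Union_word_class_profile by (auto simp: F_def)
  qed
  also have "\<dots> = (\<Sum>M\<in>?S. \<Sum>us\<in>word_class_profile p M. F (length (concat us)))"
    using fin card_word_class_profile(1) word_class_profile_disjoint
    by (intro sum.UNION_disjoint) blast+
  also have "\<dots> = (\<Sum>M\<in>?S. real (card (word_class_profile p M)) * F (\<Sum>v\<in>set p. count_list p v * size (M v)))"
    by (intro sum.cong refl) (simp add: length_concat_word_class_profile del: length_concat)
  also have "\<dots> = (\<Sum>M\<in>?S. real (n + 1 - (\<Sum>v\<in>set p. count_list p v * size (M v))) *
       (\<Prod>v\<in>set p. class_prob (card A) (M v) ^ count_list p v))"
  proof (intro sum.cong refl)
    fix M :: "'v \<Rightarrow> 'a multiset"
    have "(\<Prod>v\<in>set p. class_prob (card A) (M v) ^ count_list p v)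
        = real (card (word_class_profile p M)) / real (card A) ^ (\<Sum>v\<in>set p. count_list p v * size (M v))"
      unfolding card_word_class_profile(2) class_prob_def
      by (simp add: power_divide prod_dividef power_sum mult.commute flip: power_mult)
    then show "real (card (word_class_profile p M)) * F (\<Sum>v\<in>set p. count_list p v * size (M v))
        = real (n + 1 - (\<Sum>v\<in>set p. count_list p v * size (M v))) *
          (\<Prod>v\<in>set p. class_prob (card A) (M v) ^ count_list p v)"
      by (simp add: F_def)
  qed
  finally show ?thesis .
qed

section \<open>Power sums of class probabilities as multinomial sums\<close>

text \<open>For \<open>k \<ge> 1\<close> and a finite nonempty alphabet, this is the probability
  that \<open>k\<close> independent uniform words of length \<open>l\<close> are rearrangements of
  each other.\<close>

definition class_prob_power_sum :: "'a set \<Rightarrow> nat \<Rightarrow> nat \<Rightarrow> real" where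
  "class_prob_power_sum A k l = (\<Sum>M\<in>multisets_of_size A l. class_prob (card A) M ^ k)"

text \<open>Words of length \<open>l\<close> are partitioned by their letter multisets. This gives
  weight \<open>1\<close> to variables occurring once and absorbs one factor in the summability
  bound.\<close>

lemma sum_class_prob:
  assumes "finite A" and "card A > 0"
  shows "(\<Sum>M\<in>multisets_of_size A l. class_prob (card A) M) = 1"
proof -
  have "{w. set w \<subseteq> A \<and> length w = l} = (\<Union>M\<in>multisets_of_size A l. permutations_of_multiset M)"
    by (auto simp: multisets_of_size_def permutations_of_multiset_def)
  then have "card A ^ l = card (\<Union>M\<in>multisets_of_size A l. permutations_of_multiset M)"
    using card_lists_length_eq[OF assms(1), of l] by simp
  also have "\<dots> = (\<Sum>M\<in>multisets_of_size A l. card (permutations_of_multiset M))"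
    by (intro card_UN_disjoint finite_multisets_of_size assms ballI finite_permutations_of_multiset)
      (auto simp: permutations_of_multiset_def)
  finally have total: "(\<Sum>M\<in>multisets_of_size A l. real (card (permutations_of_multiset M))) = real (card A) ^ l"
    by (metis of_nat_power of_nat_sum)
  have "(\<Sum>M\<in>multisets_of_size A l. class_prob (card A) M)
      = (\<Sum>M\<in>multisets_of_size A l. real (card (permutations_of_multiset M)) / real (card A) ^ l)"
    by (intro sum.cong) (auto simp: class_prob_def multisets_of_size_def)
  also have "\<dots> = 1"
    unfolding sum_divide_distrib[symmetric] total using assms(2) by simp
  finally show ?thesis .
qed

lemma sum_list_map_count:
  assumes "distinct xs" and "set_mset M \<subseteq> set xs"
  shows "sum_list (map (count M) xs) = size M"
proof -
  have "sum_list (map (count M) xs) = (\<Sum>x\<in>set xs. count M x)"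
    using assms(1) by (rule sum_list_distinct_conv_sum_set)
  also have "\<dots> = (\<Sum>x\<in>set_mset M. count M x)"
    using assms(2) by (intro sum.mono_neutral_right) (auto simp: not_in_iff)
  finally show ?thesis by (simp add: size_multiset_overloaded_eq)
qed

lemma card_permutations_eq_multinomial:
  assumes "distinct xs" and "set_mset M \<subseteq> set xs"
  shows "real (card (permutations_of_multiset M)) = multinomial (map (count M) xs)"
proof -
  have "(\<Prod>i\<leftarrow>map (count M) xs. fact i :: real) = (\<Prod>x\<in>set xs. fact (count M x))"
    using assms(1) by (simp add: prod.distinct_set_conv_list o_def)
  also have "\<dots> = (\<Prod>x\<in>set_mset M. fact (count M x))"
    using assms(2) by (intro prod.mono_neutral_right) (auto simp: not_in_iff)
  finally have eq: "(\<Prod>i\<leftarrow>map (count M) xs. fact i :: real) = (\<Prod>x\<in>set_mset M. fact (count M x))" .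
  have "real (card (permutations_of_multiset M)) * (\<Prod>x\<in>set_mset M. fact (count M x)) = fact (size M)"
    using arg_cong[OF card_permutations_of_multiset_aux[of M], of real] by simp
  moreover have "(\<Prod>x\<in>set_mset M. fact (count M x) :: real) > 0"
    by (intro prod_pos) auto
  ultimately show ?thesis
    unfolding multinomial_def eq sum_list_map_count[OF assms] by (simp add: field_simps)
qed

text \<open>An enumeration \<open>xs\<close> of the alphabet turns multisets into tuples of letter
  counts, the index set of the sums in the theorem.\<close>

lemma bij_betw_multisets_count_lists:
  assumes "distinct xs"
  shows "bij_betw (\<lambda>M. map (count M) xs) (multisets_of_size (set xs) l)
    {is. length is = length xs \<and> sum_list is = l}"
  unfolding bij_betw_def
proof (intro conjI equalityI subsetI)
  show "inj_on (\<lambda>M. map (count M) xs) (multisets_of_size (set xs) l)"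
  proof (rule inj_onI, rule multiset_eqI)
    fix M N x assume "M \<in> multisets_of_size (set xs) l" "N \<in> multisets_of_size (set xs) l"
      and "map (count M) xs = map (count N) xs"
    then show "count M x = count N x"
      by (cases "x \<in> set xs") (simp, metis count_inI multisets_of_size_subset subsetD)
  qed
  fix "is" assume "is \<in> {is. length is = length xs \<and> sum_list is = l}"
  then have len: "length is = length xs" and sum: "sum_list is = l" by auto
  define M where "M = (\<Sum>i<length xs. replicate_mset (is ! i) (xs ! i))"
  have "count M (xs ! j) = is ! j" if "j < length xs" for j
  proof -
    have "count M (xs ! j) = (\<Sum>i<length xs. if i = j then is ! i else 0)"
      unfolding M_def count_sum using assms that
      by (intro sum.cong) (auto simp: nth_eq_iff_index_eq)
    then show ?thesis using that by simp
  qed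
  then have map: "map (count M) xs = is"
    using len by (auto intro: nth_equalityI)
  moreover have "set_mset M \<subseteq> set xs"
    unfolding M_def by (auto simp: set_mset_sum split: if_splits)
  ultimately show "is \<in> (\<lambda>M. map (count M) xs) ` multisets_of_size (set xs) l"
    using sum_list_map_count[OF assms, of M] sum
    by (auto simp: multisets_of_size_def intro!: image_eqI[of _ _ M])
qed (use sum_list_map_count[OF assms] in \<open>auto simp: multisets_of_size_def\<close>)

lemma class_prob_power_sum_eq:
  assumes "finite A"
  shows "class_prob_power_sum A k l = 1 / real (card A) ^ (k * l) * multinomial_power_sum (card A) k l"
proof -
  obtain xs where xs: "set xs = A" "distinct xs"
    using finite_distinct_list[OF assms] by blast
  then have "card A = length xs"
    by (metis distinct_card)
  have "class_prob_power_sum A k l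
      = (\<Sum>M\<in>multisets_of_size A l. (multinomial (map (count M) xs) / real (card A) ^ l) ^ k)"
    unfolding class_prob_power_sum_def using xs
    by (intro sum.cong) (auto simp: class_prob_def multisets_of_size_def card_permutations_eq_multinomial)
  also have "\<dots> = (\<Sum>is | length is = card A \<and> sum_list is = l. (multinomial is / real (card A) ^ l) ^ k)"
    using sum.reindex_bij_betw[OF bij_betw_multisets_count_lists[OF xs(2), of l],
        of "\<lambda>is. (multinomial is / real (card A) ^ l) ^ k"]
    unfolding xs(1) \<open>card A = length xs\<close> .
  also have "\<dots> = 1 / real (card A) ^ (k * l) * multinomial_power_sum (card A) k l"
    by (simp add: multinomial_power_sum_def power_divide sum_divide_distrib mult.commute flip: power_mult)
  finally show ?thesis .
qed

section \<open>Positivity and summability of the power sums\<close>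

lemma class_prob_nonneg: "class_prob m M \<ge> 0"
  by (simp add: class_prob_def)

lemma class_prob_le:
  assumes "finite A" and "card A \<ge> 4" and "l > 0" and "M \<in> multisets_of_size A l"
  shows "class_prob (card A) M \<le> real (card A) powr (3 / 2) * real l powr (- 3 / 2)"
proof -
  obtain xs where xs: "set xs = A" "distinct xs"
    using finite_distinct_list[OF assms(1)] by blast
  have M: "set_mset M \<subseteq> set xs" "size M = l"
    using assms(4) xs by (auto simp: multisets_of_size_def)
  have "class_prob (card A) M = multinomial (map (count M) xs) / real (card A) ^ l"
    using M xs by (simp add: class_prob_def card_permutations_eq_multinomial)
  also have "\<dots> \<le> balanced_prob (card A) (l div card A)"
    using multinomial_over_power_le[of "map (count M) xs" "card A"] distinct_card[OF xs(2)]
      sum_list_map_count[OF xs(2) M(1)] M(2) xs(1) assms(2) by simp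
  also have "\<dots> \<le> real (card A) powr (3 / 2) * real l powr (- 3 / 2)"
    by (rule balanced_prob_div_le[OF assms(2,3)])
  finally show ?thesis .
qed

lemma class_prob_power_sum_nonneg: "class_prob_power_sum A k l \<ge> 0"
  unfolding class_prob_power_sum_def by (intro sum_nonneg zero_le_power class_prob_nonneg)

text \<open>The multiset repeating a single letter already contributes a positive term. Positivity
  allows division by the limiting constant at the end.\<close>

lemma class_prob_power_sum_pos:
  assumes "finite A" and "card A > 0"
  shows "class_prob_power_sum A k l > 0"
proof -
  obtain a where "a \<in> A"
    using assms by fastforce
  then have a: "replicate_mset l a \<in> multisets_of_size A l"
    by (auto simp: multisets_of_size_def)
  show ?thesis
    unfolding class_prob_power_sum_def
  proof (rule sum_pos2[OF _ a])
    have "permutations_of_multiset (replicate_mset l a) \<noteq> {}"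
      by simp
    then show "0 < class_prob (card A) (replicate_mset l a) ^ k"
      using assms(2) by (simp add: class_prob_def card_gt_0_iff)
  qed (simp_all add: finite_multisets_of_size assms class_prob_nonneg)
qed

text \<open>With \<open>k \<ge> 2\<close>, one factor of each power is bounded uniformly by
  \<open>B\<close>, and the remaining probabilities sum to \<open>1\<close>; what is left is a
  multiple of \<open>l powr (- 3 / 2)\<close>.\<close>

lemma summable_class_prob_power_sum:
  assumes "finite A" and "card A \<ge> 4" and "k \<ge> 2"
  shows "summable (\<lambda>l. class_prob_power_sum A k (Suc l))"
proof (rule summable_comparison_test')
  define B where "B = (\<lambda>l. real (card A) powr (3 / 2) * real l powr (- 3 / 2))"
  have "summable B"
    unfolding B_def by (intro summable_mult) (simp add: summable_real_powr_iff)
  then show "summable (\<lambda>l. B (Suc l))"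
    by (subst summable_Suc_iff)
  fix l :: nat
  have prob_1: "(\<Sum>M\<in>multisets_of_size A (Suc l). class_prob (card A) M) = 1"
    using sum_class_prob[OF assms(1)] assms(2) by simp
  have "class_prob_power_sum A k (Suc l)
      \<le> (\<Sum>M\<in>multisets_of_size A (Suc l). B (Suc l) * class_prob (card A) M)"
    unfolding class_prob_power_sum_def
  proof (rule sum_mono)
    fix M assume M: "M \<in> multisets_of_size A (Suc l)"
    have "class_prob (card A) M \<le> 1"
      using member_le_sum[OF M, of "class_prob (card A)"] prob_1
      by (simp add: class_prob_nonneg finite_multisets_of_size[OF assms(1)])
    then have "class_prob (card A) M ^ k \<le> class_prob (card A) M ^ 2"
      using assms(3) by (intro power_decreasing class_prob_nonneg)
    also have "\<dots> \<le> B (Suc l) * class_prob (card A) M"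
      unfolding power2_eq_square B_def
      by (intro mult_right_mono class_prob_le assms M class_prob_nonneg) simp
    finally show "class_prob (card A) M ^ k \<le> B (Suc l) * class_prob (card A) M" .
  qed
  also have "\<dots> = B (Suc l)"
    by (simp add: prob_1 flip: sum_distrib_left)
  finally show "norm (class_prob_power_sum A k (Suc l)) \<le> B (Suc l)"
    by (simp add: class_prob_power_sum_nonneg)
qed

section \<open>Reduction of the mean to the iterated sum\<close>

text \<open>The last variable is peeled off: a multiset of size \<open>l\<close> uses up
  \<open>k (Suc j) * l\<close> of the budget \<open>N\<close>. The size bound \<open>R\<close> stays
  fixed while \<open>N\<close> shrinks, so the induction hypothesis concerns the same
  multisets.\<close>

lemma sum_profiles_eq_conv_sum:
  fixes A :: "'a set"
  assumes "finite A" and "\<And>i. i \<in> {1..j} \<Longrightarrow> k i \<ge> 1" and "N \<le> R"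
  shows "(\<Sum>M\<in>{1..j} \<rightarrow>\<^sub>E short_multisets A R.
       real (N - (\<Sum>i=1..j. k i * size (M i))) * (\<Prod>i=1..j. class_prob (card A) (M i) ^ k i))
    = conv_sum (\<lambda>i. class_prob_power_sum A (k i)) k j N"
  using assms(2,3)
proof (induction j arbitrary: N)
  case 0
  then show ?case by simp
next
  case (Suc j)
  let ?S = "short_multisets A R"
  let ?h = "\<lambda>j N M. real (N - (\<Sum>i=1..j. k i * size (M i))) * (\<Prod>i=1..j. class_prob (card A) (M i) ^ k i)"
  let ?c = "\<lambda>i. class_prob_power_sum A (k i)"
  let ?k = "k (Suc j)"
  have ins: "{1..Suc j} = insert (Suc j) {1..j}" by auto
  have "(\<Sum>M\<in>{1..Suc j} \<rightarrow>\<^sub>E ?S. ?h (Suc j) N M)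
      = (\<Sum>(X, M)\<in>?S \<times> ({1..j} \<rightarrow>\<^sub>E ?S). ?h (Suc j) N (M(Suc j := X)))"
    unfolding ins PiE_insert_eq
    by (subst sum.reindex) (auto intro!: inj_combinator simp: case_prod_beta o_def)
  also have "\<dots> = (\<Sum>(X, M)\<in>?S \<times> ({1..j} \<rightarrow>\<^sub>E ?S). class_prob (card A) X ^ ?k * ?h j (N - ?k * size X) M)"
  proof -
    have "(\<Sum>i=1..Suc j. k i * size ((M(Suc j := X)) i)) = ?k * size X + (\<Sum>i=1..j. k i * size (M i))"
      for X and M :: "nat \<Rightarrow> 'a multiset"
      by simp
    moreover have "(\<Prod>i=1..Suc j. class_prob (card A) ((M(Suc j := X)) i) ^ k i)
        = class_prob (card A) X ^ ?k * (\<Prod>i=1..j. class_prob (card A) (M i) ^ k i)"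
      for X and M :: "nat \<Rightarrow> 'a multiset"
      by simp
    ultimately show ?thesis
      by (simp only: diff_diff_left mult_ac)
  qed
  also have "\<dots> = (\<Sum>X\<in>?S. class_prob (card A) X ^ ?k * (\<Sum>M\<in>{1..j} \<rightarrow>\<^sub>E ?S. ?h j (N - ?k * size X) M))"
    by (simp only: sum.cartesian_product[symmetric] sum_distrib_left)
  also have "\<dots> = (\<Sum>X\<in>?S. class_prob (card A) X ^ ?k * conv_sum ?c k j (N - ?k * size X))"
    using Suc.prems by (intro sum.cong refl arg_cong2[of _ _ _ _ "(*)"] Suc.IH) auto
  also have "\<dots> = (\<Sum>l=1..R. \<Sum>X\<in>multisets_of_size A l. class_prob (card A) X ^ ?k * conv_sum ?c k j (N - ?k * size X))"
    by (intro sum.UNION_disjoint) (auto simp: finite_multisets_of_size[OF assms(1)], auto simp: multisets_of_size_def)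
  also have "\<dots> = (\<Sum>l=1..R. ?c (Suc j) l * conv_sum ?c k j (N - ?k * l))"
    unfolding class_prob_power_sum_def sum_distrib_right
    by (intro sum.cong refl) (simp add: multisets_of_size_def)
  \<comment> \<open>Sizes above \<open>N\<close> exhaust the budget because
    \<open>?k \<ge> 1\<close>, and \<open>conv_sum\<close> vanishes at \<open>0\<close>.\<close>
  also have "\<dots> = (\<Sum>l=1..N. ?c (Suc j) l * conv_sum ?c k j (N - ?k * l))"
  proof (rule sum.mono_neutral_right)
    have vanish: "N - ?k * l = 0" if "l > N" for l
    proof -
      have "N \<le> 1 * l" using that by simp
      also have "\<dots> \<le> ?k * l"
        using Suc.prems(1)[of "Suc j"] by (intro mult_le_mono1) simp
      finally show ?thesis by simp
    qed
    show "\<forall>l\<in>{1..R} - {1..N}. ?c (Suc j) l * conv_sum ?c k j (N - ?k * l) = 0"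
    proof
      fix l assume "l \<in> {1..R} - {1..N}"
      then have "l > N" by auto
      then show "?c (Suc j) l * conv_sum ?c k j (N - ?k * l) = 0"
        by (simp only: vanish conv_sum_zero mult_zero_right)
    qed
  qed (use Suc.prems in auto)
  finally show ?case by simp
qed

text \<open>Only the coincidences between positions of \<open>p\<close> matter, so variables may be
  renamed injectively.\<close>

lemma abelian_instances_map:
  assumes "inj_on f (set p)"
  shows "abelian_instances A (map f p) = abelian_instances A p"
  unfolding abelian_instances_def
  by (intro Collect_cong conj_cong) (use assms in \<open>auto simp: inj_on_eq_iff\<close>)

lemma count_list_map_inj_on:
  assumes "inj_on f (insert x (set p))"
  shows "count_list (map f p) (f x) = count_list p x"
  using assms by (induction p) (auto simp: inj_on_def)

lemma mean_abelian_occurrences_eq_conv_sum: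
  fixes p :: "'v list" and var :: "nat \<Rightarrow> 'v"
  assumes "finite A" and "card A > 0" and var: "bij_betw var {1..r} (set p)"
    and k: "\<And>j. j \<in> {1..r} \<Longrightarrow> k j = count_list p (var j)"
  shows "mean_abelian_occurrences A p n = conv_sum (\<lambda>i. class_prob_power_sum A (k i)) k r (n + 1)"
proof -
  \<comment> \<open>Variables are renamed to their indices, the range over which
    \<open>conv_sum\<close> recurses.\<close>
  define q where "q = map (the_inv_into {1..r} var) p"
  have inj: "inj_on (the_inv_into {1..r} var) (set p)"
    using var by (metis bij_betw_def bij_betw_the_inv_into)
  have set_q: "set q = {1..r}"
    using bij_betw_the_inv_into[OF var] by (simp add: q_def bij_betw_def)
  have count_q: "count_list q j = k j" if "j \<in> {1..r}" for j
  proof -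
    have "var j \<in> set p" "the_inv_into {1..r} var (var j) = j"
      using var that by (auto simp: bij_betw_def the_inv_into_f_f)
    then have "count_list q j = count_list p (var j)"
      using count_list_map_inj_on[of "the_inv_into {1..r} var" "var j" p] inj
      by (simp add: q_def insert_absorb)
    then show ?thesis using k[OF that] by simp
  qed
  have k_pos: "k j \<ge> 1" if "j \<in> {1..r}" for j
    using that count_q[OF that] set_q by (metis One_nat_def Suc_leI count_list_0_iff neq0_conv)
  have "mean_abelian_occurrences A p n = mean_abelian_occurrences A q n"
    unfolding mean_abelian_occurrences_def abelian_occurrences_def q_def
    unfolding abelian_instances_map[OF inj] ..
  also have "\<dots> = (\<Sum>M\<in>{1..r} \<rightarrow>\<^sub>E short_multisets A (n + 1).
       real (n + 1 - (\<Sum>i=1..r. k i * size (M i))) * (\<Prod>i=1..r. class_prob (card A) (M i) ^ k i))"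
    unfolding mean_abelian_occurrences_eq_sum_profiles[OF assms(1,2)] set_q
    by (simp add: count_q)
  also have "\<dots> = conv_sum (\<lambda>i. class_prob_power_sum A (k i)) k r (n + 1)"
    by (intro sum_profiles_eq_conv_sum assms k_pos) auto
  finally show ?thesis .
qed

subsection \<open>Asymptotics of the mean\<close>

text \<open>The summability conjunct certifies that each infinite sum is the value of a convergent
  series rather than a default; \<open>Suc l\<close> starts it at \<open>1\<close>.\<close>

theorem theorem7:
  fixes A :: "'a set" and p :: "'v list"
    and var :: "nat \<Rightarrow> 'v" and k :: "nat \<Rightarrow> nat" and m r s :: nat
  assumes "m \<ge> 4" and "finite A" and "card A = m"
    and "p \<noteq> []" and "r \<ge> 1"
    and "bij_betw var {1..r} (set p)"
    and "\<And>j. j \<in> {1..r} \<Longrightarrow> k j = count_list p (var j)"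
    and "s \<le> r"
    and "\<And>j. j \<in> {1..s} \<Longrightarrow> k j = 1"
    and "\<And>j. j \<in> {s+1..r} \<Longrightarrow> 1 < k j"
    and "mono_on {s+1..r} k"
  shows "(\<forall>j\<in>{s+1..r}.
            summable (\<lambda>l. 1 / real m ^ (k j * Suc l) * multinomial_power_sum m (k j) (Suc l))) \<and>
         (\<lambda>n. mean_abelian_occurrences A p n) \<sim>[at_top]
         (\<lambda>n. real n ^ (s + 1) / fact (s + 1) *
            (\<Prod>j\<in>{s+1..r}.
               \<Sum>l. 1 / real m ^ (k j * Suc l) * multinomial_power_sum m (k j) (Suc l)))"
proof -
  define c where "c = (\<lambda>i. class_prob_power_sum A (k i))"
  have card: "card A > 0" "card A \<ge> 4"
    using assms(1,3) by auto
  have c: "1 / real m ^ (k j * Suc l) * multinomial_power_sum m (k j) (Suc l) = c j (Suc l)" for j l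
    using class_prob_power_sum_eq[OF assms(2)] assms(3) by (simp add: c_def)
  have c_sum: "summable (\<lambda>l. c j (Suc l))" if "j \<in> {s+1..r}" for j
    unfolding c_def using assms(10)[OF that] by (intro summable_class_prob_power_sum assms(2) card) simp
  define K where "K = (\<Prod>j\<in>{s+1..r}. \<Sum>l. c j (Suc l)) / fact (s + 1)"
  have "K > 0"
    unfolding K_def c_def using c_sum[unfolded c_def] card assms(2)
    by (intro divide_pos_pos prod_pos suminf_pos class_prob_power_sum_pos) auto
  have "(\<lambda>N. conv_sum c k r N / real N ^ (s + 1)) \<longlonglongrightarrow> K"
  proof -
    have "c i l = 1" if "i \<in> {1..s}" for i l
      using sum_class_prob[OF assms(2) card(1)] assms(9)[OF that]
      by (simp add: c_def class_prob_power_sum_def)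
    moreover have "c i l \<ge> 0" for i l
      by (simp add: c_def class_prob_power_sum_nonneg)
    ultimately have "(\<lambda>N. conv_sum c k r N / real N ^ (s + 1))
        \<longlonglongrightarrow> 1 / fact (s + 1) * (\<Prod>j\<in>{s+1..r}. \<Sum>l. c j (Suc l))"
      using c_sum assms(9,10) by (intro conv_sum_tendsto assms(8)) (auto simp: less_imp_le)
    then show ?thesis by (simp add: K_def)
  qed
  then have lim: "(\<lambda>n. conv_sum c k r (n + 1) / real (n + 1) ^ (s + 1)) \<longlonglongrightarrow> K"
    by (rule LIMSEQ_ignore_initial_segment)
  \<comment> \<open>The natural variable of \<open>conv_sum\<close> is \<open>n + 1\<close>; the
    ratio \<open>n / (n + 1)\<close> converts the normalisation to powers of
    \<open>n\<close>.\<close>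
  have "(\<lambda>n. conv_sum c k r (n + 1) / real (n + 1) ^ (s + 1) / (real n / real (n + 1)) ^ (s + 1) / K)
      \<longlonglongrightarrow> K / 1 ^ (s + 1) / K"
    using \<open>K > 0\<close> by (intro tendsto_intros lim tendsto_shift_ratio) auto
  \<comment> \<open>The identity holds even at \<open>n = 0\<close>, where division by zero makes
    both sides \<open>0\<close>.\<close>
  moreover have "eventually (\<lambda>n.
      conv_sum c k r (n + 1) / real (n + 1) ^ (s + 1) / (real n / real (n + 1)) ^ (s + 1) / K
      = conv_sum c k r (n + 1) / (real n ^ (s + 1) * K)) at_top"
    by (intro always_eventually allI) (simp add: power_divide del: of_nat_add of_nat_Suc power_Suc)
  ultimately have "(\<lambda>n. conv_sum c k r (n + 1) / (real n ^ (s + 1) * K)) \<longlonglongrightarrow> 1"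
    using \<open>K > 0\<close> by (auto elim: Lim_transform_eventually)
  then have "(\<lambda>n. conv_sum c k r (n + 1)) \<sim>[at_top] (\<lambda>n. real n ^ (s + 1) * K)"
    by (rule asymp_equivI')
  moreover have "mean_abelian_occurrences A p n = conv_sum c k r (n + 1)" for n
    unfolding c_def by (rule mean_abelian_occurrences_eq_conv_sum[OF assms(2) card(1) assms(6,7)])
  ultimately show ?thesis
    using c_sum unfolding c by (simp add: K_def)
qed

end
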